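(* Let $0<\theta\leq 1$, $0\leq\nu\leq1$, let $a\in\mathbb{R}\setminus\{0\}$ and let $\psi$ be a compactly supported fractional wavelet. Then the operator $f\mapsto (L_\psi^\theta f)(\cdot,a)$ is a bounded operator from $L^{1,\nu}_{M}(\mathbb{R})$ to $L^{1,\nu}_{M}(\mathbb{R})$. Furthermore, for every $f\in L^{1,\nu}_M(\mathbb{R})$, $$\|(L_\psi^\theta f)(\cdot,a)\|_{L^{1,\nu}_{M}(\mathbb{R})}\leq\frac{|a|^{\frac{1}{2\theta}}}{\sqrt{C_{\psi,\theta}}}\,\|\psi\|_{L^1(\mathbb{R})}\,\|f\|_{L^{1,\nu}_{M}(\mathbb{R})}.$$
   Context: Functions are complex-valued on $\mathbb{R}$. For $0<\theta\leq1$, the fractional Fourier transform is $(\mathfrak{F}_\theta f)(\xi)=\int_{\mathbb{R}}e^{-i(\operatorname{sgn}\xi)|\xi|^{1/\theta}t}f(t)\,dt$. A fractional wavelet (of order $\theta$) is a non-zero function $\psi\in L^1(\mathbb{R})\cap L^2(\mathbb{R})$ with $C_{\psi,\theta}:=\int_{\mathbb{R}}\frac{|(\mathfrak{F}_\theta\psi)(\xi)|^2}{|\xi|}\,d\xi<\infty$. For $a\in\mathbb{R}\setminus\{0\}$, $b\in\mathbb{R}$, put $\psi_{a,b,\theta}(t)=\frac{1}{|a|^{1/(2\theta)}}\psi\left(\frac{t-b}{(\operatorname{sgn} a)|a|^{1/\theta}}\right)$. The continuous fractional wavelet transform (CFrWT) of $f$ is $(W_\psi^\theta f)(b,a)=\int_{\mathbb{R}}f(t)\overline{\psi_{a,b,\theta}(t)}\,dt$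 whenever the integral is well-defined, and its normalized form is $L_\psi^\theta:=\frac{1}{\sqrt{C_{\psi,\theta}}}W_\psi^\theta$. For fixed $a$, $(L_\psi^\theta f)(\cdot,a)$ is regarded as a function of $b$ (defined almost everywhere). Morrey space: for $0\leq\nu\leq1$, $L^{1,\nu}_M(\mathbb{R})$ is the set of $f\in L^1_{loc}(\mathbb{R})$ with $\|f\|_{L^{1,\nu}_M(\mathbb{R})}:=\sup_{x\in\mathbb{R},\,r>0}\frac{1}{r^\nu}\int_{B(x,r)}|f(t)|\,dt<\infty$, where $B(x,r)$ is the ball (interval) of centre $x$ and radius $r$. *)

theory Defs
  imports "HOL-Analysis.Analysis"
begin

text \<open>
  Measurability and integrals are with respect to the completed Lebesgue measure. Elements of
  function spaces are represented by functions \<^typ>\<open>real \<Rightarrow> complex\<close>, so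
  identities between elements of these spaces are stated almost everywhere.
\<close>

definition frac_fourier :: "real \<Rightarrow> (real \<Rightarrow> complex) \<Rightarrow> real \<Rightarrow> complex" where
  "frac_fourier \<theta> f \<xi> =
     (\<integral>t. exp (- \<i> * complex_of_real (sgn \<xi> * \<bar>\<xi>\<bar> powr (1 / \<theta>) * t)) * f t \<partial>lebesgue)"

text \<open>
  At \<open>\<xi> = 0\<close> the integrand below is 0 by the convention for division; this
  affects only a null set.
\<close>

definition admissible_density :: "real \<Rightarrow> (real \<Rightarrow> complex) \<Rightarrow> real \<Rightarrow> real" where
  "admissible_density \<theta> \<psi> \<xi> = (cmod (frac_fourier \<theta> \<psi> \<xi>))\<^sup>2 / \<bar>\<xi>\<bar>"

definition wavelet_const :: "real \<Rightarrow> (real \<Rightarrow> complex) \<Rightarrow> real" where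
  "wavelet_const \<theta> \<psi> = (\<integral>\<xi>. admissible_density \<theta> \<psi> \<xi> \<partial>lebesgue)"

text \<open>
  The last conjunct is the finiteness of the defining integral of \<^const>\<open>wavelet_const\<close>,
  whose integrand is nonnegative. Non-zero means non-zero as an element of \<open>L\<^sup>1\<close>.
\<close>

definition fractional_wavelet :: "real \<Rightarrow> (real \<Rightarrow> complex) \<Rightarrow> bool" where
  "fractional_wavelet \<theta> \<psi> \<longleftrightarrow>
     integrable lebesgue \<psi> \<and>
     integrable lebesgue (\<lambda>t. (cmod (\<psi> t))\<^sup>2) \<and>
     \<not> (AE t in lebesgue. \<psi> t = 0) \<and>
     integrable lebesgue (admissible_density \<theta> \<psi>)"

definition compactly_supported :: "(real \<Rightarrow> complex) \<Rightarrow> bool" where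
  "compactly_supported \<psi> \<longleftrightarrow> (\<exists>K. compact K \<and> (AE t in lebesgue. t \<notin> K \<longrightarrow> \<psi> t = 0))"

definition wavelet_atom :: "real \<Rightarrow> (real \<Rightarrow> complex) \<Rightarrow> real \<Rightarrow> real \<Rightarrow> real \<Rightarrow> complex" where
  "wavelet_atom \<theta> \<psi> a b t =
     complex_of_real (1 / \<bar>a\<bar> powr (1 / (2 * \<theta>))) * \<psi> ((t - b) / (sgn a * \<bar>a\<bar> powr (1 / \<theta>)))"

definition cfrwt_defined ::
    "real \<Rightarrow> (real \<Rightarrow> complex) \<Rightarrow> (real \<Rightarrow> complex) \<Rightarrow> real \<Rightarrow> real \<Rightarrow> bool" where
  "cfrwt_defined \<theta> \<psi> f b a \<longleftrightarrow> integrable lebesgue (\<lambda>t. f t * cnj (wavelet_atom \<theta> \<psi> a b t))"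

text \<open>
  The value is meaningful where \<^const>\<open>cfrwt_defined\<close> holds; elsewhere the library integral
  is 0.
\<close>

definition cfrwt :: "real \<Rightarrow> (real \<Rightarrow> complex) \<Rightarrow> (real \<Rightarrow> complex) \<Rightarrow> real \<Rightarrow> real \<Rightarrow> complex" where
  "cfrwt \<theta> \<psi> f b a = (\<integral>t. f t * cnj (wavelet_atom \<theta> \<psi> a b t) \<partial>lebesgue)"

definition normalized_cfrwt ::
    "real \<Rightarrow> (real \<Rightarrow> complex) \<Rightarrow> (real \<Rightarrow> complex) \<Rightarrow> real \<Rightarrow> real \<Rightarrow> complex" where
  "normalized_cfrwt \<theta> \<psi> f b a =
     complex_of_real (1 / sqrt (wavelet_const \<theta> \<psi>)) * cfrwt \<theta> \<psi> f b a"

definition locally_integrable :: "(real \<Rightarrow> complex) \<Rightarrow> bool" where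
  "locally_integrable f \<longleftrightarrow> (\<forall>K. compact K \<longrightarrow> set_integrable lebesgue K f)"

definition morrey_norm :: "real \<Rightarrow> (real \<Rightarrow> complex) \<Rightarrow> ennreal" where
  "morrey_norm \<nu> f =
     (SUP x. SUP r\<in>{0<..}.
        ennreal (1 / r powr \<nu>) * (\<integral>\<^sup>+t\<in>ball x r. ennreal (cmod (f t)) \<partial>lebesgue))"

definition morrey :: "real \<Rightarrow> (real \<Rightarrow> complex) set" where
  "morrey \<nu> = {f. locally_integrable f \<and> morrey_norm \<nu> f < \<infinity>}"

text \<open>
  Boundedness of a linear operator on the Morrey space, whose elements are classes of functions
  modulo equality almost everywhere: the second condition says that \<open>T\<close> acts on
  classes.
\<close>

definition bounded_morrey_operator ::
    "real \<Rightarrow> ((real \<Rightarrow> complex) \<Rightarrow> (real \<Rightarrow> complex)) \<Rightarrow> bool" where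
  "bounded_morrey_operator \<nu> T \<longleftrightarrow>
     (\<forall>f\<in>morrey \<nu>. T f \<in> morrey \<nu>) \<and>
     (\<forall>f\<in>morrey \<nu>. \<forall>g\<in>morrey \<nu>.
        (AE t in lebesgue. f t = g t) \<longrightarrow> (AE b in lebesgue. T f b = T g b)) \<and>
     (\<forall>f\<in>morrey \<nu>. \<forall>g\<in>morrey \<nu>. \<forall>\<alpha> \<beta>.
        AE b in lebesgue. T (\<lambda>t. \<alpha> * f t + \<beta> * g t) b = \<alpha> * T f b + \<beta> * T g b) \<and>
     (\<exists>C::real. C \<ge> 0 \<and> (\<forall>f\<in>morrey \<nu>. morrey_norm \<nu> (T f) \<le> ennreal C * morrey_norm \<nu> f))"

end

theory Submission
  imports Defs
begin

text \<open>
  Substituting \<open>t = b + s u\<close> turns \<open>\<integral> f(t) \<phi>((t - b)/s) dt\<close> into an average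
  \<open>\<bar>s\<bar> \<integral> \<phi>(u) f(b + s u) du\<close> of translates of \<open>f\<close>. Integrating its modulus over a ball in
  \<open>b\<close> and exchanging the integrals leaves integrals of \<open>\<bar>f\<bar>\<close> over translated balls of the same
  radius, each of which the Morrey norm controls. With \<open>s = sgn a \<cdot> \<bar>a\<bar>\<^bsup>1/\<theta>\<^esup>\<close> the factor
  \<open>\<bar>s\<bar>\<close> and the normalization \<open>\<bar>a\<bar>\<^bsup>-1/(2\<theta>)\<^esup>\<close> combine to \<open>\<bar>a\<bar>\<^bsup>1/(2\<theta>)\<^esup>\<close>.
\<close>

section \<open>Borel representatives, affine substitutions and measurability\<close>

text \<open>Borel representatives can be composed with affine maps in two variables, which is what
  the exchange of integrals needs. Real and imaginary parts are replaced separately.\<close>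

lemma ex_borel_version:
  fixes f :: "'a::euclidean_space \<Rightarrow> complex"
  assumes f: "f \<in> borel_measurable lebesgue"
  obtains g where "g \<in> borel_measurable borel" "AE x in lborel. f x = g x"
proof -
  have "(\<lambda>x. Re (f x)) \<in> borel_measurable lebesgue" "(\<lambda>x. Im (f x)) \<in> borel_measurable lebesgue"
    using f by measurable
  from this[THEN completion_ex_borel_measurable_real]
  obtain u v where uv: "u \<in> borel_measurable lborel" "v \<in> borel_measurable lborel"
    and ae: "AE x in lborel. Re (f x) = u x" "AE x in lborel. Im (f x) = v x"
    by blast
  show thesis
  proof
    show "(\<lambda>x. Complex (u x) (v x)) \<in> borel_measurable borel"
      using uv unfolding Complex_eq by simp
    show "AE x in lborel. f x = Complex (u x) (v x)"
      using ae by eventually_elim (simp add: complex_eq_iff)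
  qed
qed

text \<open>\<open>P\<close> is an arbitrary predicate, so the exceptional set is first enlarged to
  a Borel null set \<open>N\<close>. Membership in \<open>N\<close> is measurable and can be pulled
  back along the affine map.\<close>

lemma AE_lborel_affine:
  fixes c :: real
  assumes c: "c \<noteq> 0" and P: "AE x in lborel. P x"
  shows "AE x in lborel. P (t + c * x)"
proof -
  obtain N where N: "N \<in> null_sets lborel" "{x. \<not> P x} \<subseteq> N"
    using P by (auto simp: eventually_ae_filter)
  have "AE x in lborel. x \<notin> N"
    using N(1) by (rule AE_not_in)
  then have "AE x in lborel. t + c * x \<notin> N"
    using N(1) by (intro AE_borel_affine[OF c]) (auto simp: null_sets_def pred_def)
  then show ?thesis
    by eventually_elim (use N(2) in blast)
qed

text \<open>The truncations of \<open>f\<close> to the balls \<open>cball 0 n\<close> are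
  integrable, hence measurable, and at each point they are eventually equal to
  \<open>f\<close>.\<close>

lemma locally_integrable_measurable:
  assumes "locally_integrable f"
  shows "f \<in> borel_measurable lebesgue"
proof (rule borel_measurable_LIMSEQ_metric)
  fix n :: nat
  show "(\<lambda>x. indicator (cball 0 (real n)) x *\<^sub>R f x) \<in> borel_measurable lebesgue"
    using assms unfolding locally_integrable_def set_integrable_def
    by (meson borel_measurable_integrable compact_cball)
next
  fix x :: real
  obtain N :: nat where N: "\<bar>x\<bar> \<le> real N"
    using real_arch_simple by blast
  have "\<forall>\<^sub>F n in sequentially. indicator (cball 0 (real n)) x *\<^sub>R f x = f x"
    using eventually_ge_at_top[of N] by eventually_elim (use N in auto)
  then show "(\<lambda>n. indicator (cball 0 (real n)) x *\<^sub>R f x) \<longlonglongrightarrow> f x"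
    by (rule tendsto_eventually)
qed

section \<open>The Morrey norm\<close>

lemma ball_integral_le_morrey_norm:
  assumes r: "0 < r"
  shows "(\<integral>\<^sup>+t\<in>ball x r. ennreal (cmod (f t)) \<partial>lebesgue) \<le> ennreal (r powr \<nu>) * morrey_norm \<nu> f"
proof -
  let ?I = "\<integral>\<^sup>+t\<in>ball x r. ennreal (cmod (f t)) \<partial>lebesgue"
  have "ennreal (1 / r powr \<nu>) * ?I \<le> morrey_norm \<nu> f"
    unfolding morrey_norm_def using r by (intro SUP_upper2[of x] SUP_upper) auto
  then have "ennreal (r powr \<nu>) * (ennreal (1 / r powr \<nu>) * ?I) \<le> ennreal (r powr \<nu>) * morrey_norm \<nu> f"
    by (rule mult_left_mono) simp
  moreover have "ennreal (r powr \<nu>) * ennreal (1 / r powr \<nu>) = 1"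
    using r by (simp flip: ennreal_mult)
  ultimately show ?thesis
    by (simp flip: mult.assoc)
qed

lemma morrey_norm_leI:
  assumes "\<And>x r. 0 < r \<Longrightarrow>
    (\<integral>\<^sup>+t\<in>ball x r. ennreal (cmod (f t)) \<partial>lebesgue) \<le> ennreal (r powr \<nu>) * B"
  shows "morrey_norm \<nu> f \<le> B"
  unfolding morrey_norm_def
proof (intro SUP_least)
  fix x r :: real
  assume "r \<in> {0<..}"
  then have r: "0 < r" by simp
  have "ennreal (1 / r powr \<nu>) * (\<integral>\<^sup>+t\<in>ball x r. ennreal (cmod (f t)) \<partial>lebesgue)
      \<le> ennreal (1 / r powr \<nu>) * (ennreal (r powr \<nu>) * B)"
    by (intro mult_left_mono assms r) simp
  also have "\<dots> = B"
    using r by (simp flip: mult.assoc ennreal_mult)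
  finally show "ennreal (1 / r powr \<nu>) * (\<integral>\<^sup>+t\<in>ball x r. ennreal (cmod (f t)) \<partial>lebesgue) \<le> B" .
qed

text \<open>A compact set lies in some ball \<open>ball 0 r\<close>, and the integral of the modulus
  over that ball is at most \<open>r powr \<nu>\<close> times the norm. Local integrability
  therefore follows from measurability and a finite norm.\<close>

lemma morreyI:
  assumes f: "f \<in> borel_measurable lebesgue" and fin: "morrey_norm \<nu> f < \<infinity>"
  shows "f \<in> morrey \<nu>"
proof -
  have "set_integrable lebesgue K f" if K: "compact K" for K
  proof -
    obtain r where r: "0 < r" "K \<subseteq> ball 0 r"
      using compact_imp_bounded[OF K] bounded_subset_ballD by blast
    have "K \<in> sets lebesgue"
      using K by (simp add: compact_imp_closed)
    moreover have "(\<integral>\<^sup>+x. norm (indicator K x *\<^sub>R f x) \<partial>lebesgue)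
        \<le> (\<integral>\<^sup>+t\<in>ball 0 r. ennreal (cmod (f t)) \<partial>lebesgue)"
      using r by (intro nn_integral_mono) (auto split: split_indicator)
    moreover have "\<dots> < \<infinity>"
      using ball_integral_le_morrey_norm[OF r(1), where x = 0 and f = f and \<nu> = \<nu>] fin
      by (auto simp: ennreal_mult_less_top intro: le_less_trans)
    ultimately show ?thesis
      using f unfolding set_integrable_def by (intro integrableI_bounded) auto
  qed
  with fin show ?thesis
    by (simp add: morrey_def locally_integrable_def)
qed

lemma morrey_measurable:
  "f \<in> morrey \<nu> \<Longrightarrow> f \<in> borel_measurable lebesgue"
  by (simp add: morrey_def locally_integrable_measurable)

section \<open>Correlation with a dilated kernel and its Morrey estimate\<close>

text \<open>This is the wavelet transform stripped of its scalar factors: \<open>\<phi>\<close>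
  stands for the conjugate of the wavelet and \<open>s\<close> for the signed dilation
  factor.\<close>

definition dilated_correlation ::
    "real \<Rightarrow> (real \<Rightarrow> complex) \<Rightarrow> (real \<Rightarrow> complex) \<Rightarrow> real \<Rightarrow> complex" where
  "dilated_correlation s \<phi> f b = (\<integral>t. f t * \<phi> ((t - b) / s) \<partial>lebesgue)"

text \<open>
  Lebesgue measurability does not make \<open>(b, u) \<mapsto> f (b + s * u)\<close> measurable for the product of
  the completed measures, so the exchange of integrals is done for Borel functions.
\<close>

lemma ball_integral_correlation_le_borel:
  fixes f \<phi> :: "real \<Rightarrow> complex"
  assumes [measurable]: "f \<in> borel_measurable borel" "\<phi> \<in> borel_measurable borel"
    and s: "s \<noteq> 0" and r: "0 < r"
  shows "(\<integral>\<^sup>+b\<in>ball x r. (\<integral>\<^sup>+t. ennreal (cmod (f t * \<phi> ((t - b) / s))) \<partial>lborel) \<partial>lborel)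
    \<le> ennreal (r powr \<nu>) * (ennreal \<bar>s\<bar> * (\<integral>\<^sup>+u. ennreal (cmod (\<phi> u)) \<partial>lborel) * morrey_norm \<nu> f)"
proof -
  let ?B = "ennreal (r powr \<nu>) * morrey_norm \<nu> f"
  have [measurable]: "ball y r \<in> sets borel" for y :: real
    by simp
  have "(\<integral>\<^sup>+b\<in>ball x r. (\<integral>\<^sup>+t. ennreal (cmod (f t * \<phi> ((t - b) / s))) \<partial>lborel) \<partial>lborel)
      = (\<integral>\<^sup>+b. (\<integral>\<^sup>+u. ennreal \<bar>s\<bar> * (ennreal (cmod (\<phi> u)) *
            (ennreal (cmod (f (b + s * u))) * indicator (ball x r) b)) \<partial>lborel) \<partial>lborel)"
  proof (intro nn_integral_cong)
    fix b :: real
    have "(\<integral>\<^sup>+t. ennreal (cmod (f t * \<phi> ((t - b) / s))) \<partial>lborel)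
        = ennreal \<bar>s\<bar> * (\<integral>\<^sup>+u. ennreal (cmod (f (b + s * u) * \<phi> u)) \<partial>lborel)"
      using s by (subst nn_integral_real_affine[of _ s b]) auto
    \<comment> \<open>The indicator depends on \<open>b\<close> alone, so it may move under the
      integral over \<open>u\<close>; the double integral then has a single integrand.\<close>
    then show "(\<integral>\<^sup>+t. ennreal (cmod (f t * \<phi> ((t - b) / s))) \<partial>lborel) * indicator (ball x r) b
        = (\<integral>\<^sup>+u. ennreal \<bar>s\<bar> * (ennreal (cmod (\<phi> u)) *
            (ennreal (cmod (f (b + s * u))) * indicator (ball x r) b)) \<partial>lborel)"
      by (simp add: nn_integral_cmult norm_mult ennreal_mult mult_ac split: split_indicator)
  qed
  \<comment> \<open>Tonelli: the integrand is nonnegative and jointly Borel, so no integrability has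
    to be known beforehand.\<close>
  also have "\<dots> = (\<integral>\<^sup>+u. (\<integral>\<^sup>+b. ennreal \<bar>s\<bar> * (ennreal (cmod (\<phi> u)) *
            (ennreal (cmod (f (b + s * u))) * indicator (ball x r) b)) \<partial>lborel) \<partial>lborel)"
    by (rule lborel_pair.Fubini'[symmetric]) measurable
  also have "\<dots> = (\<integral>\<^sup>+u. ennreal \<bar>s\<bar> * (ennreal (cmod (\<phi> u)) *
            (\<integral>\<^sup>+y\<in>ball (x + s * u) r. ennreal (cmod (f y)) \<partial>lebesgue)) \<partial>lborel)"
  proof (intro nn_integral_cong)
    fix u :: real
    \<comment> \<open>For fixed \<open>u\<close> the map from \<open>b\<close> to
      \<open>b + s * u\<close> is a translation, so the ball keeps its radius; \<open>s\<close> only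
      moves the centre.\<close>
    have "(\<integral>\<^sup>+y\<in>ball (x + s * u) r. ennreal (cmod (f y)) \<partial>lebesgue)
       = (\<integral>\<^sup>+b. ennreal (cmod (f (b + s * u))) * indicator (ball x r) b \<partial>lborel)"
      unfolding nn_integral_completion
      by (subst nn_integral_real_affine[of _ 1 "s * u"])
        (auto intro!: nn_integral_cong simp: dist_real_def add.commute split: split_indicator)
    then show "(\<integral>\<^sup>+b. ennreal \<bar>s\<bar> * (ennreal (cmod (\<phi> u)) *
            (ennreal (cmod (f (b + s * u))) * indicator (ball x r) b)) \<partial>lborel)
        = ennreal \<bar>s\<bar> * (ennreal (cmod (\<phi> u)) *
            (\<integral>\<^sup>+y\<in>ball (x + s * u) r. ennreal (cmod (f y)) \<partial>lebesgue))"
      by (simp add: nn_integral_cmult)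
  qed
  also have "\<dots> \<le> (\<integral>\<^sup>+u. ennreal \<bar>s\<bar> * (ennreal (cmod (\<phi> u)) * ?B) \<partial>lborel)"
    by (intro nn_integral_mono mult_left_mono ball_integral_le_morrey_norm r) auto
  also have "\<dots> = ennreal \<bar>s\<bar> * ((\<integral>\<^sup>+u. ennreal (cmod (\<phi> u)) \<partial>lborel) * ?B)"
    by (simp add: nn_integral_cmult nn_integral_multc)
  finally show ?thesis
    by (simp add: mult_ac)
qed

text \<open>For fixed \<open>b\<close>, the map from \<open>t\<close> to \<open>(t - b) / s\<close>
  is affine with nonzero slope \<open>1 / s\<close>, so it pulls null sets back to null
  sets.\<close>

lemma AE_correlation_integrand_cong:
  fixes f g \<phi> \<eta> :: "real \<Rightarrow> complex"
  assumes "s \<noteq> 0" "AE t in lborel. f t = g t" "AE t in lborel. \<phi> t = \<eta> t"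
  shows "AE t in lebesgue. f t * \<phi> ((t - b) / s) = g t * \<eta> ((t - b) / s)"
proof -
  have "AE t in lborel. \<phi> (- b / s + (1 / s) * t) = \<eta> (- b / s + (1 / s) * t)"
    using assms by (intro AE_lborel_affine) auto
  with assms(2) have "AE t in lborel. f t * \<phi> ((t - b) / s) = g t * \<eta> ((t - b) / s)"
    by eventually_elim (simp add: diff_divide_distrib)
  then show ?thesis
    by (rule AE_completion)
qed

text \<open>The claim is clear for Borel representatives, and changing a function on a null set
  preserves measurability because Lebesgue measure is complete.\<close>

lemma correlation_integrand_measurable:
  fixes f \<phi> :: "real \<Rightarrow> complex"
  assumes "s \<noteq> 0" "f \<in> borel_measurable lebesgue" "\<phi> \<in> borel_measurable lebesgue"
  shows "(\<lambda>t. f t * \<phi> ((t - b) / s)) \<in> borel_measurable lebesgue"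
proof -
  obtain g \<eta> where [measurable]: "g \<in> borel_measurable borel" "\<eta> \<in> borel_measurable borel"
    and ae: "AE t in lborel. f t = g t" "AE t in lborel. \<phi> t = \<eta> t"
    using assms ex_borel_version by metis
  have "(\<lambda>t. g t * \<eta> ((t - b) / s)) \<in> borel_measurable lebesgue"
    by (rule measurable_completion) measurable
  moreover have "AE t in lebesgue. g t * \<eta> ((t - b) / s) = f t * \<phi> ((t - b) / s)"
    using AE_correlation_integrand_cong[OF assms(1) ae] by (simp add: eq_commute)
  ultimately show ?thesis
    by (rule borel_measurable_AE)
qed

text \<open>Equality holds at every \<open>b\<close>, not just almost every \<open>b\<close>: for
  each fixed \<open>b\<close> the two integrands agree for almost all \<open>t\<close>.\<close>

lemma dilated_correlation_cong:
  assumes "s \<noteq> 0" "f \<in> borel_measurable lebesgue" "g \<in> borel_measurable lebesgue"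
    "\<phi> \<in> borel_measurable lebesgue" "\<eta> \<in> borel_measurable lebesgue"
    "AE t in lborel. f t = g t" "AE t in lborel. \<phi> t = \<eta> t"
  shows "dilated_correlation s \<phi> f b = dilated_correlation s \<eta> g b"
  unfolding dilated_correlation_def
  using assms by (intro integral_cong_AE correlation_integrand_measurable AE_correlation_integrand_cong)

text \<open>Borel representatives give the very same function of \<open>b\<close>, and for them the
  integrand is jointly Borel, so its integral over \<open>t\<close> is Borel in
  \<open>b\<close>.\<close>

lemma dilated_correlation_measurable:
  assumes "s \<noteq> 0" "f \<in> borel_measurable lebesgue" "\<phi> \<in> borel_measurable lebesgue"
  shows "dilated_correlation s \<phi> f \<in> borel_measurable lebesgue"
proof -
  obtain g \<eta> where [measurable]: "g \<in> borel_measurable borel" "\<eta> \<in> borel_measurable borel"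
    and ae: "AE t in lborel. f t = g t" "AE t in lborel. \<phi> t = \<eta> t"
    using assms ex_borel_version by metis
  have "dilated_correlation s \<phi> f b = (\<integral>t. g t * \<eta> ((t - b) / s) \<partial>lborel)" for b
  proof -
    have "dilated_correlation s \<phi> f b = dilated_correlation s \<eta> g b"
      using assms ae by (intro dilated_correlation_cong) (auto intro: measurable_completion)
    then show ?thesis
      by (simp add: dilated_correlation_def integral_completion)
  qed
  then have "dilated_correlation s \<phi> f = (\<lambda>b. \<integral>t. g t * \<eta> ((t - b) / s) \<partial>lborel)"
    by (rule ext)
  also have "\<dots> \<in> borel_measurable lebesgue"
    by (rule measurable_completion) measurable
  finally show ?thesis .
qed

lemma morrey_norm_cong:
  assumes "AE t in lborel. f t = g t"
  shows "morrey_norm \<nu> f = morrey_norm \<nu> g"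
proof -
  have "(\<integral>\<^sup>+t\<in>A. ennreal (cmod (f t)) \<partial>lebesgue) = (\<integral>\<^sup>+t\<in>A. ennreal (cmod (g t)) \<partial>lebesgue)" for A
    unfolding nn_integral_completion
    by (intro nn_integral_cong_AE) (use assms in eventually_elim, simp)
  then show ?thesis
    by (simp add: morrey_norm_def)
qed

text \<open>Every quantity in the Borel estimate is unchanged by passing to Borel representatives.
  Measurability in \<open>b\<close> is recorded for deducing almost everywhere finiteness from a
  finite integral.\<close>

lemma ball_integral_correlation_le:
  fixes f \<phi> :: "real \<Rightarrow> complex"
  assumes f: "f \<in> borel_measurable lebesgue" and \<phi>: "\<phi> \<in> borel_measurable lebesgue"
    and s: "s \<noteq> 0" and r: "0 < r"
  shows "(\<integral>\<^sup>+b\<in>ball x r. (\<integral>\<^sup>+t. ennreal (cmod (f t * \<phi> ((t - b) / s))) \<partial>lebesgue) \<partial>lebesgue)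
    \<le> ennreal (r powr \<nu>) * (ennreal \<bar>s\<bar> * (\<integral>\<^sup>+u. ennreal (cmod (\<phi> u)) \<partial>lebesgue) * morrey_norm \<nu> f)"
    (is "?L \<le> _")
    and "(\<lambda>b. \<integral>\<^sup>+t. ennreal (cmod (f t * \<phi> ((t - b) / s))) \<partial>lebesgue) \<in> borel_measurable lebesgue"
proof -
  obtain g \<eta> where [measurable]: "g \<in> borel_measurable borel" "\<eta> \<in> borel_measurable borel"
    and ae: "AE t in lborel. f t = g t" "AE t in lborel. \<phi> t = \<eta> t"
    using assms ex_borel_version by metis
  have inner: "(\<integral>\<^sup>+t. ennreal (cmod (f t * \<phi> ((t - b) / s))) \<partial>lebesgue)
      = (\<integral>\<^sup>+t. ennreal (cmod (g t * \<eta> ((t - b) / s))) \<partial>lborel)" for b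
  proof -
    have "(\<integral>\<^sup>+t. ennreal (cmod (f t * \<phi> ((t - b) / s))) \<partial>lebesgue)
        = (\<integral>\<^sup>+t. ennreal (cmod (g t * \<eta> ((t - b) / s))) \<partial>lebesgue)"
      by (intro nn_integral_cong_AE)
        (use AE_correlation_integrand_cong[OF s ae, of b] in eventually_elim, simp)
    then show ?thesis
      by (simp add: nn_integral_completion)
  qed
  have \<phi>_eq: "(\<integral>\<^sup>+u. ennreal (cmod (\<phi> u)) \<partial>lebesgue) = (\<integral>\<^sup>+u. ennreal (cmod (\<eta> u)) \<partial>lborel)"
    unfolding nn_integral_completion
    by (intro nn_integral_cong_AE) (use ae(2) in eventually_elim, simp)
  show "?L \<le> ennreal (r powr \<nu>) *
      (ennreal \<bar>s\<bar> * (\<integral>\<^sup>+u. ennreal (cmod (\<phi> u)) \<partial>lebesgue) * morrey_norm \<nu> f)"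
    unfolding inner \<phi>_eq morrey_norm_cong[OF ae(1)]
    unfolding nn_integral_completion
    by (rule ball_integral_correlation_le_borel) (use s r in auto)
  show "(\<lambda>b. \<integral>\<^sup>+t. ennreal (cmod (f t * \<phi> ((t - b) / s))) \<partial>lebesgue) \<in> borel_measurable lebesgue"
    unfolding inner by (rule measurable_completion) measurable
qed

text \<open>On each ball about 0 the integral of \<open>?J\<close> is finite, so \<open>?J\<close>
  is finite almost everywhere there; countably many such balls cover the line.\<close>

lemma AE_correlation_integrable:
  assumes f: "f \<in> morrey \<nu>" and \<phi>: "integrable lebesgue \<phi>" and s: "s \<noteq> 0"
  shows "AE b in lebesgue. integrable lebesgue (\<lambda>t. f t * \<phi> ((t - b) / s))"
proof -
  let ?J = "\<lambda>b. \<integral>\<^sup>+t. ennreal (cmod (f t * \<phi> ((t - b) / s))) \<partial>lebesgue"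
  note meas = morrey_measurable[OF f] borel_measurable_integrable[OF \<phi>]
  have [measurable]: "ball 0 (real n) \<in> sets lebesgue" for n
    by simp
  \<comment> \<open>The radius is \<open>Suc n\<close> because the ball estimate requires it to be
    positive.\<close>
  have "AE b in lebesgue. ?J b * indicator (ball 0 (real (Suc n))) b \<noteq> \<infinity>" for n
  proof (rule nn_integral_PInf_AE)
    show "(\<lambda>b. ?J b * indicator (ball 0 (real (Suc n))) b) \<in> borel_measurable lebesgue"
      using ball_integral_correlation_le(2)[OF meas s, of 1] by measurable
    have "(\<integral>\<^sup>+u. ennreal (cmod (\<phi> u)) \<partial>lebesgue) < \<infinity>" "morrey_norm \<nu> f < \<infinity>"
      using \<phi> f by (auto simp: integrable_iff_bounded morrey_def)
    then have "ennreal (real (Suc n) powr \<nu>) *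
        (ennreal \<bar>s\<bar> * (\<integral>\<^sup>+u. ennreal (cmod (\<phi> u)) \<partial>lebesgue) * morrey_norm \<nu> f) < \<infinity>"
      by (simp add: ennreal_mult_less_top)
    with ball_integral_correlation_le(1)[OF meas s, of "real (Suc n)" 0 \<nu>]
    show "(\<integral>\<^sup>+b\<in>ball 0 (real (Suc n)). ?J b \<partial>lebesgue) \<noteq> \<infinity>"
      by (auto dest: le_less_trans)
  qed
  then have "AE b in lebesgue. \<forall>n. ?J b * indicator (ball 0 (real (Suc n))) b \<noteq> \<infinity>"
    by (simp add: AE_all_countable)
  then show ?thesis
  proof eventually_elim
    case (elim b)
    obtain n :: nat where "\<bar>b\<bar> < real n"
      using reals_Archimedean2 by blast
    then have "?J b < \<infinity>"
      using elim[rule_format, of n] by (simp add: less_top)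
    then show ?case
      using correlation_integrand_measurable[OF s meas] by (intro integrableI_bounded)
  qed
qed

lemma morrey_norm_dilated_correlation_le:
  assumes f: "f \<in> borel_measurable lebesgue" and \<phi>: "integrable lebesgue \<phi>" and s: "s \<noteq> 0"
  shows "morrey_norm \<nu> (dilated_correlation s \<phi> f)
    \<le> ennreal (\<bar>s\<bar> * (\<integral>u. cmod (\<phi> u) \<partial>lebesgue)) * morrey_norm \<nu> f"
proof (rule morrey_norm_leI)
  fix x r :: real
  assume r: "0 < r"
  have "(\<integral>\<^sup>+b\<in>ball x r. ennreal (cmod (dilated_correlation s \<phi> f b)) \<partial>lebesgue)
      \<le> (\<integral>\<^sup>+b\<in>ball x r. (\<integral>\<^sup>+t. ennreal (cmod (f t * \<phi> ((t - b) / s))) \<partial>lebesgue) \<partial>lebesgue)"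
  proof (intro nn_integral_mono mult_right_mono)
    fix b
    show "ennreal (cmod (dilated_correlation s \<phi> f b))
        \<le> (\<integral>\<^sup>+t. ennreal (cmod (f t * \<phi> ((t - b) / s))) \<partial>lebesgue)"
    proof (cases "integrable lebesgue (\<lambda>t. f t * \<phi> ((t - b) / s))")
      case True
      then show ?thesis
        unfolding dilated_correlation_def by (rule integral_norm_bound_ennreal)
    next
      \<comment> \<open>The integral defaults to 0 here, so the pointwise bound holds at every
        \<open>b\<close> without an exceptional set.\<close>
      case False
      then show ?thesis
        by (simp add: dilated_correlation_def not_integrable_integral_eq)
    qed
  qed simp
  also have "\<dots> \<le> ennreal (r powr \<nu>) *
      (ennreal \<bar>s\<bar> * (\<integral>\<^sup>+u. ennreal (cmod (\<phi> u)) \<partial>lebesgue) * morrey_norm \<nu> f)"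
    by (rule ball_integral_correlation_le(1)[OF f borel_measurable_integrable[OF \<phi>] s r])
  also have "(\<integral>\<^sup>+u. ennreal (cmod (\<phi> u)) \<partial>lebesgue) = ennreal (\<integral>u. cmod (\<phi> u) \<partial>lebesgue)"
    using \<phi> by (intro nn_integral_eq_integral) auto
  finally show "(\<integral>\<^sup>+b\<in>ball x r. ennreal (cmod (dilated_correlation s \<phi> f b)) \<partial>lebesgue)
      \<le> ennreal (r powr \<nu>) * (ennreal (\<bar>s\<bar> * (\<integral>u. cmod (\<phi> u) \<partial>lebesgue)) * morrey_norm \<nu> f)"
    by (simp add: ennreal_mult)
qed

lemma morrey_norm_cmult:
  assumes f: "f \<in> borel_measurable lebesgue"
  shows "morrey_norm \<nu> (\<lambda>t. c * f t) = ennreal (cmod c) * morrey_norm \<nu> f"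
proof -
  have "(\<integral>\<^sup>+t\<in>A. ennreal (cmod (c * f t)) \<partial>lebesgue)
      = ennreal (cmod c) * (\<integral>\<^sup>+t\<in>A. ennreal (cmod (f t)) \<partial>lebesgue)" if "A \<in> sets lebesgue" for A
    using that f
    by (subst nn_integral_cmult[symmetric]) (auto simp: norm_mult ennreal_mult mult.assoc)
  then have "ennreal (1 / r powr \<nu>) * (\<integral>\<^sup>+t\<in>ball x r. ennreal (cmod (c * f t)) \<partial>lebesgue)
      = ennreal (cmod c) * (ennreal (1 / r powr \<nu>) * (\<integral>\<^sup>+t\<in>ball x r. ennreal (cmod (f t)) \<partial>lebesgue))"
    for x r by (simp add: mult_ac)
  then show ?thesis
    unfolding morrey_norm_def by (simp add: SUP_mult_left_ennreal)
qed

section \<open>The wavelet transform as a scaled dilated correlation\<close>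

theorem theorem4p3:
  fixes \<theta> \<nu> a :: real and \<psi> :: "real \<Rightarrow> complex"
  assumes "0 < \<theta>" and "\<theta> \<le> 1" and "0 \<le> \<nu>" and "\<nu> \<le> 1" and "a \<noteq> 0"
    and "fractional_wavelet \<theta> \<psi>" and "compactly_supported \<psi>"
  shows "(\<forall>f\<in>morrey \<nu>. AE b in lebesgue. cfrwt_defined \<theta> \<psi> f b a) \<and>
    bounded_morrey_operator \<nu> (\<lambda>f b. normalized_cfrwt \<theta> \<psi> f b a) \<and>
    (\<forall>f\<in>morrey \<nu>.
       morrey_norm \<nu> (\<lambda>b. normalized_cfrwt \<theta> \<psi> f b a)
         \<le> ennreal (\<bar>a\<bar> powr (1 / (2 * \<theta>)) / sqrt (wavelet_const \<theta> \<psi>)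
                     * (\<integral>t. cmod (\<psi> t) \<partial>lebesgue)) * morrey_norm \<nu> f)"
proof -
  define s where "s = sgn a * \<bar>a\<bar> powr (1 / \<theta>)"
  define \<phi> where "\<phi> t = cnj (\<psi> t)" for t
  define k where "k = 1 / \<bar>a\<bar> powr (1 / (2 * \<theta>))"
  define w where "w = 1 / sqrt (wavelet_const \<theta> \<psi>)"
  define C where "C = \<bar>a\<bar> powr (1 / (2 * \<theta>)) / sqrt (wavelet_const \<theta> \<psi>) * (\<integral>t. cmod (\<psi> t) \<partial>lebesgue)"
  let ?T = "\<lambda>f b. normalized_cfrwt \<theta> \<psi> f b a"
  have s: "s \<noteq> 0" "\<bar>s\<bar> = \<bar>a\<bar> powr (1 / \<theta>)"
    using \<open>a \<noteq> 0\<close> by (auto simp: s_def abs_mult sgn_zero_iff)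
  have k: "0 < k"
    using \<open>a \<noteq> 0\<close> by (simp add: k_def)
  \<comment> \<open>Nonnegativity suffices: at the value 0 the convention for division would make
    both \<open>w\<close> and \<open>C\<close> vanish, consistently with the bound.\<close>
  have "0 \<le> wavelet_const \<theta> \<psi>"
    unfolding wavelet_const_def admissible_density_def by (intro integral_nonneg_AE) simp
  then have w: "0 \<le> w"
    by (simp add: w_def)
  have C: "0 \<le> C"
    using \<open>0 \<le> wavelet_const \<theta> \<psi>\<close> by (simp add: C_def)
  have "integrable lebesgue \<psi>"
    using assms by (simp add: fractional_wavelet_def)
  then have \<phi>: "integrable lebesgue \<phi>" and norm_\<phi>: "(\<integral>t. cmod (\<phi> t) \<partial>lebesgue) = (\<integral>t. cmod (\<psi> t) \<partial>lebesgue)"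
    by (simp_all add: \<phi>_def[abs_def])
  have integrand: "f t * cnj (wavelet_atom \<theta> \<psi> a b t) = of_real k * (f t * \<phi> ((t - b) / s))" for f b t
    by (simp add: wavelet_atom_def k_def \<phi>_def s_def)
  have T_eq: "?T f b = of_real (w * k) * dilated_correlation s \<phi> f b" for f b
    unfolding normalized_cfrwt_def cfrwt_def integrand dilated_correlation_def
    by (simp add: w_def)
  have defined: "AE b in lebesgue. integrable lebesgue (\<lambda>t. f t * \<phi> ((t - b) / s))"
    if "f \<in> morrey \<nu>" for f
    by (rule AE_correlation_integrable[OF that \<phi> s(1)])
  have meas: "dilated_correlation s \<phi> f \<in> borel_measurable lebesgue" if "f \<in> morrey \<nu>" for f
    using dilated_correlation_measurable[OF s(1) morrey_measurable[OF that]] \<phi> by auto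
  have "\<bar>a\<bar> powr (1 / \<theta>) = \<bar>a\<bar> powr (1 / (2 * \<theta>)) * \<bar>a\<bar> powr (1 / (2 * \<theta>))"
    by (simp flip: powr_add)
  \<comment> \<open>One of the two factors \<open>\<bar>a\<bar> powr (1 / (2 * \<theta>))\<close> of
    \<open>\<bar>s\<bar>\<close> cancels against \<open>k\<close>, the other remains in
    \<open>C\<close>.\<close>
  then have const: "w * k * (\<bar>s\<bar> * (\<integral>t. cmod (\<phi> t) \<partial>lebesgue)) = C"
    using \<open>a \<noteq> 0\<close> by (simp add: C_def w_def k_def s norm_\<phi>)
  have bound: "morrey_norm \<nu> (?T f) \<le> ennreal C * morrey_norm \<nu> f" if f: "f \<in> morrey \<nu>" for f
  proof -
    have "morrey_norm \<nu> (?T f) = ennreal (w * k) * morrey_norm \<nu> (dilated_correlation s \<phi> f)"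
      unfolding T_eq using w k by (subst morrey_norm_cmult[OF meas[OF f]]) (simp add: norm_mult)
    also have "\<dots> \<le> ennreal (w * k) *
        (ennreal (\<bar>s\<bar> * (\<integral>u. cmod (\<phi> u) \<partial>lebesgue)) * morrey_norm \<nu> f)"
      by (intro mult_left_mono morrey_norm_dilated_correlation_le[OF morrey_measurable[OF f] \<phi> s(1)]) simp
    also have "\<dots> = ennreal C * morrey_norm \<nu> f"
      using w k by (simp flip: const mult.assoc ennreal_mult)
    finally show ?thesis .
  qed
  have "?T f \<in> morrey \<nu>" if f: "f \<in> morrey \<nu>" for f
  proof (rule morreyI)
    show "?T f \<in> borel_measurable lebesgue"
      unfolding T_eq using meas[OF f] by measurable
    have "morrey_norm \<nu> f < \<infinity>"
      using f by (simp add: morrey_def)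
    with bound[OF f] show "morrey_norm \<nu> (?T f) < \<infinity>"
      by (auto simp: ennreal_mult_less_top intro: le_less_trans)
  qed
  moreover have "AE b in lebesgue. ?T f b = ?T g b"
    if "f \<in> morrey \<nu>" "g \<in> morrey \<nu>" "AE t in lebesgue. f t = g t" for f g
  proof -
    have "dilated_correlation s \<phi> f b = dilated_correlation s \<phi> g b" for b
      using that \<phi> by (intro dilated_correlation_cong s(1))
        (auto simp: AE_completion_iff intro: morrey_measurable)
    then show ?thesis
      by (simp add: T_eq)
  qed
  \<comment> \<open>Additivity of the integral is used only at those \<open>b\<close> where both
    integrands are integrable; elsewhere the default value 0 could break it.\<close>
  moreover have "AE b in lebesgue. ?T (\<lambda>t. \<alpha> * f t + \<beta> * g t) b = \<alpha> * ?T f b + \<beta> * ?T g b"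
    if "f \<in> morrey \<nu>" "g \<in> morrey \<nu>" for f g \<alpha> \<beta>
    using defined[OF that(1)] defined[OF that(2)]
  proof eventually_elim
    case (elim b)
    have "dilated_correlation s \<phi> (\<lambda>t. \<alpha> * f t + \<beta> * g t) b
        = (\<integral>t. \<alpha> * (f t * \<phi> ((t - b) / s)) + \<beta> * (g t * \<phi> ((t - b) / s)) \<partial>lebesgue)"
      by (simp add: dilated_correlation_def algebra_simps)
    also have "\<dots> = \<alpha> * dilated_correlation s \<phi> f b + \<beta> * dilated_correlation s \<phi> g b"
      using elim by (simp add: dilated_correlation_def)
    finally show ?case
      unfolding T_eq by (simp add: algebra_simps)
  qed
  ultimately have "bounded_morrey_operator \<nu> ?T"
    unfolding bounded_morrey_operator_def using bound C by blast
  moreover have "AE b in lebesgue. cfrwt_defined \<theta> \<psi> f b a" if "f \<in> morrey \<nu>" for f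
    using defined[OF that] unfolding cfrwt_defined_def integrand by eventually_elim simp
  ultimately show ?thesis
    using bound unfolding C_def by blast
qed

end
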